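(* Let $h(z)=z+\sum_{n=2}^{\infty}a_nz^n$ and $g(z)=\sum_{n=1}^{\infty}b_nz^n$ be analytic in $\mathbb{D}$, and suppose that $$|a_n|\le \tfrac{1}{6}(2n+1)(n+1)\quad\text{and}\quad |b_n|\le \tfrac{1}{6}(2n-1)(n-1)\qquad\text{for all } n\ge 1,$$ where $a_1=1$. Then $f=h+\overline{g}$ is close-to-convex (in particular univalent), and starlike, in the disk $|z|<r_S$, where $$r_S=1+\frac{\sqrt{2}}{4}-\sqrt{\sqrt{2}+\frac{1}{8}}\approx 0.112903$$ is the root of the quadratic equation $$\sqrt{2}\,r^2-(1+2\sqrt{2})\,r+\sqrt{2}-1=0$$ in the interval $(0,1)$. The result is sharp: $r_S$ cannot be replaced by any larger number, i.e. for every $r\in(r_S,1]$ there are $h,g$ satisfying the hypotheses for which $f=h+\overline{g}$ is not univalent in $|z|<r$.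
   Context: $\mathbb{D}=\{z\in\mathbb{C}:|z|<1\}$. A domain $\Omega\subset\mathbb{C}$ is close-to-convex if its complement $\mathbb{C}\setminus\Omega$ is a union of closed half-lines whose interiors (open half-lines) are pairwise disjoint. A complex-valued harmonic function $f$ is called close-to-convex (resp. starlike) in a disk $|z|<r$ if it is univalent (injective) and sense-preserving there and maps that disk onto a close-to-convex domain (resp. onto a domain starlike with respect to the origin). *)

theory Defs
  imports "HOL-Complex_Analysis.Complex_Analysis"
begin

definition domain :: "complex set \<Rightarrow> bool" where
  "domain \<Omega> \<longleftrightarrow> open \<Omega> \<and> connected \<Omega> \<and> \<Omega> \<noteq> {}"

definition closed_half_line :: "complex \<Rightarrow> complex \<Rightarrow> complex set" where
  "closed_half_line p d = {p + of_real t * d | t. 0 \<le> t}"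

definition open_half_line :: "complex \<Rightarrow> complex \<Rightarrow> complex set" where
  "open_half_line p d = {p + of_real t * d | t. 0 < t}"

text \<open>A family of half-lines is a set of pairs of an end point and a unit direction vector.
  Because the directions are normalised, different pairs are different half-lines.\<close>

definition close_to_convex_domain :: "complex set \<Rightarrow> bool" where
  "close_to_convex_domain \<Omega> \<longleftrightarrow> domain \<Omega> \<and>
     (\<exists>L. (\<forall>(p, d)\<in>L. norm d = 1) \<and>
          - \<Omega> = (\<Union>(p, d)\<in>L. closed_half_line p d) \<and>
          disjoint_family_on (\<lambda>(p, d). open_half_line p d) L)"

definition starlike_domain :: "complex set \<Rightarrow> bool" where
  "starlike_domain \<Omega> \<longleftrightarrow> domain \<Omega> \<and> 0 \<in> \<Omega> \<and> (\<forall>w\<in>\<Omega>. closed_segment 0 w \<subseteq> \<Omega>)"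

definition pd_x :: "(complex \<Rightarrow> complex) \<Rightarrow> complex \<Rightarrow> complex" where
  "pd_x f z = vector_derivative (\<lambda>t. f (z + of_real t)) (at 0)"

definition pd_y :: "(complex \<Rightarrow> complex) \<Rightarrow> complex \<Rightarrow> complex" where
  "pd_y f z = vector_derivative (\<lambda>t. f (z + \<i> * of_real t)) (at 0)"

text \<open>Differentiability is real (Frechet) differentiability. The requirement on \<open>f\<close> itself makes
  the junk values of \<^const>\<open>vector_derivative\<close> irrelevant.\<close>

definition C1_on :: "complex set \<Rightarrow> (complex \<Rightarrow> complex) \<Rightarrow> bool" where
  "C1_on S f \<longleftrightarrow> f differentiable_on S \<and> continuous_on S (pd_x f) \<and> continuous_on S (pd_y f)"

definition harmonic_fun_on :: "complex set \<Rightarrow> (complex \<Rightarrow> complex) \<Rightarrow> bool" where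
  "harmonic_fun_on S f \<longleftrightarrow> open S \<and> C1_on S f \<and> C1_on S (pd_x f) \<and> C1_on S (pd_y f) \<and>
     (\<forall>z\<in>S. pd_x (pd_x f) z + pd_y (pd_y f) z = 0)"

definition jacobian :: "(complex \<Rightarrow> complex) \<Rightarrow> complex \<Rightarrow> real" where
  "jacobian f z = Re (pd_x f z) * Im (pd_y f z) - Re (pd_y f z) * Im (pd_x f z)"

text \<open>For \<open>f = h + cnj g\<close> with \<open>h\<close>, \<open>g\<close> holomorphic the Jacobian is \<open>|h'|^2 - |g'|^2\<close>.\<close>

definition sense_preserving_on :: "complex set \<Rightarrow> (complex \<Rightarrow> complex) \<Rightarrow> bool" where
  "sense_preserving_on S f \<longleftrightarrow> (\<forall>z\<in>S. jacobian f z > 0)"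

definition close_to_convex_in_disk :: "(complex \<Rightarrow> complex) \<Rightarrow> real \<Rightarrow> bool" where
  "close_to_convex_in_disk f r \<longleftrightarrow>
     harmonic_fun_on (ball 0 r) f \<and> inj_on f (ball 0 r) \<and> sense_preserving_on (ball 0 r) f \<and>
     close_to_convex_domain (f ` ball 0 r)"

definition starlike_in_disk :: "(complex \<Rightarrow> complex) \<Rightarrow> real \<Rightarrow> bool" where
  "starlike_in_disk f r \<longleftrightarrow>
     harmonic_fun_on (ball 0 r) f \<and> inj_on f (ball 0 r) \<and> sense_preserving_on (ball 0 r) f \<and>
     starlike_domain (f ` ball 0 r)"

definition coeff_bounded_pair ::
    "(nat \<Rightarrow> complex) \<Rightarrow> (nat \<Rightarrow> complex) \<Rightarrow> (complex \<Rightarrow> complex) \<Rightarrow> (complex \<Rightarrow> complex) \<Rightarrow> bool" where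
  "coeff_bounded_pair a b h g \<longleftrightarrow>
     h holomorphic_on ball 0 1 \<and> g holomorphic_on ball 0 1 \<and>
     a 1 = 1 \<and>
     (\<forall>z\<in>ball 0 1. (\<lambda>n. a (n + 2) * z ^ (n + 2)) sums (h z - z)) \<and>
     (\<forall>z\<in>ball 0 1. (\<lambda>n. b (n + 1) * z ^ (n + 1)) sums g z) \<and>
     (\<forall>n\<ge>1. norm (a n) \<le> (2 * real n + 1) * (real n + 1) / 6) \<and>
     (\<forall>n\<ge>1. norm (b n) \<le> (2 * real n - 1) * (real n - 1) / 6)"

definition r_S :: real where
  "r_S = 1 + sqrt 2 / 4 - sqrt (sqrt 2 + 1 / 8)"

end

theory Submission
  imports Defs
begin

text \<open>
  The proof compares \<open>f = h + cnj g\<close> with the identity map. If \<open>\<alpha>\<close> and \<open>\<beta>\<close> are the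
  coefficients of \<open>h z - z\<close> and \<open>g z\<close> and \<open>\<Sum> n (|\<alpha>\<^sub>n| + |\<beta>\<^sub>n|) R ^ (n - 1) \<le> 1\<close>, then
  \<open>F = f - id\<close> is a strict contraction on every smaller disk. More is true: for
  \<open>|z| \<le> |w|\<close> and \<open>0 \<le> t \<le> 1\<close> one has
  \<open>|w ^ n - t z ^ n| \<le> n |w| ^ (n - 1) |w - t z|\<close>, and summing this gives
  \<open>|F w - t F z| < |w - t z|\<close> unless \<open>w = t z\<close>. Hence \<open>f w = t f z\<close> with \<open>|z| \<le> |w|\<close> forces
  \<open>w = t z\<close>. This single rigidity statement carries the geometry. With \<open>t = 1\<close> it is
  injectivity. With general \<open>t\<close> it says that the segment from 0 to \<open>f z\<close> does not meet the image
  of any circle of radius larger than \<open>|z|\<close>. By invariance of domain the image of such a circle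
  contains the boundary of the image of the disk that it bounds, so the segment never
  leaves that image, and the image of the whole disk is starlike. The Jacobian is positive because the
  contraction estimate bounds \<open>|h' - 1| + |g'|\<close> by a number below 1.

  A starlike domain is close-to-convex for a trivial reason: its complement is the disjoint union
  of the radial half-lines that it cuts out of the rays from the origin.

  For the coefficient bounds at hand, \<open>|a\<^sub>n| + |b\<^sub>n| \<le> (2 n\<^sup>2 + 1) / 3\<close>, and the
  majorant \<open>\<Sum> n (2 n\<^sup>2 + 1) / 3 r ^ (n - 1)\<close>, linear term included, equals
  \<open>(1 + r)\<^sup>2 / (1 - r) ^ 4\<close>. It increases through the value 2 exactly at \<open>r_S\<close>, which gives
  the radius. For sharpness all coefficients but the first take the extreme value with a minus
  sign. The resulting map is real on the real axis, with derivative
  \<open>2 - (1 + x)\<^sup>2 / (1 - x) ^ 4\<close>, so it turns back at \<open>r_S\<close> and is not injective on a larger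
  disk.
\<close>

section \<open>A dilated power inequality\<close>

text \<open>The point \<open>t w\<close> is the point of the ball of radius \<open>t |w|\<close> nearest to \<open>w\<close>, and \<open>t z\<close>
  lies in that ball; so moving from \<open>t w\<close> out to \<open>w\<close> only increases the distance to \<open>t z\<close>.\<close>

lemma scaled_dist_le_dist_scaled:
  fixes z w :: "'a::real_inner"
  assumes "norm z \<le> norm w" "0 \<le> t" "t \<le> 1"
  shows "t * norm (w - z) \<le> norm (w - t *\<^sub>R z)"
proof -
  have "norm w * norm z \<le> norm w * norm w"
    using assms by (intro mult_left_mono) auto
  then have zw: "inner w z \<le> (norm w)\<^sup>2"
    using norm_cauchy_schwarz[of w z] by (simp add: power2_eq_square)
  have "(norm (w - t *\<^sub>R z))\<^sup>2 - (t * norm (w - z))\<^sup>2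
      = (1 - t) * ((1 + t) * (norm w)\<^sup>2 - 2 * t * inner w z)"
    by (simp add: power_mult_distrib power2_norm_eq_inner inner_diff inner_commute)
       (simp add: power2_eq_square algebra_simps)
  also have "\<dots> \<ge> (1 - t) * ((1 + t) * (norm w)\<^sup>2 - 2 * t * (norm w)\<^sup>2)"
    using assms zw by (intro mult_left_mono diff_mono order_refl) auto
  also have "(1 - t) * ((1 + t) * (norm w)\<^sup>2 - 2 * t * (norm w)\<^sup>2) = ((1 - t) * norm w)\<^sup>2"
    by (simp add: power2_eq_square algebra_simps)
  finally have "(t * norm (w - z))\<^sup>2 \<le> (norm (w - t *\<^sub>R z))\<^sup>2"
    using zero_le_power2[of "(1 - t) * norm w"] by linarith
  then show ?thesis
    by (rule power2_le_imp_le) simp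
qed

text \<open>For \<open>t = 1\<close> this is the mean value bound for the power function. The point is that the
  dilation \<open>t\<close> multiplies \<open>z ^ n\<close> and not \<open>z\<close> inside the power, as it must for comparing \<open>f w\<close>
  with \<open>t f z\<close>. Splitting off \<open>w\<close> leaves the remainder \<open>z ^ (n + 1) t (w - z)\<close>, which the
  preceding inequality absorbs.\<close>

lemma norm_power_diff_dilated_le:
  fixes z w :: complex
  assumes "norm z \<le> norm w" "0 \<le> t" "t \<le> 1"
  shows "norm (w ^ Suc n - of_real t * z ^ Suc n)
         \<le> real (Suc n) * norm w ^ n * norm (w - of_real t * z)"
proof (induction n)
  case 0
  then show ?case by simp
next
  case (Suc n)
  have "w ^ Suc (Suc n) - of_real t * z ^ Suc (Suc n)
      = w * (w ^ Suc n - of_real t * z ^ Suc n) + z ^ Suc n * (of_real t * (w - z))"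
    by (simp add: algebra_simps)
  also have "norm \<dots> \<le> norm w * norm (w ^ Suc n - of_real t * z ^ Suc n)
      + norm z ^ Suc n * (t * norm (w - z))"
    using assms by (intro order_trans[OF norm_triangle_ineq]) (simp add: norm_mult norm_power)
  also have "\<dots> \<le> norm w * (real (Suc n) * norm w ^ n * norm (w - of_real t * z))
      + norm w ^ Suc n * norm (w - of_real t * z)"
    using assms scaled_dist_le_dist_scaled[OF assms]
    by (intro add_mono mult_left_mono mult_mono power_mono Suc.IH)
       (auto simp: scaleR_conv_of_real)
  also have "\<dots> = real (Suc (Suc n)) * norm w ^ Suc n * norm (w - of_real t * z)"
    by (simp add: algebra_simps)
  finally show ?case .
qed

section \<open>Sums of a holomorphic and an antiholomorphic function\<close>

lemma has_derivative_add_cnj: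
  assumes "open S" "z \<in> S" "h holomorphic_on S" "g holomorphic_on S"
    and f: "\<And>w. w \<in> S \<Longrightarrow> f w = h w + cnj (g w)"
  shows "(f has_derivative (\<lambda>v. deriv h z * v + cnj (deriv g z * v))) (at z)"
proof -
  have "((\<lambda>w. h w + cnj (g w)) has_derivative (\<lambda>v. deriv h z * v + cnj (deriv g z * v))) (at z)"
    using assms holomorphic_derivI[of h S z] holomorphic_derivI[of g S z]
    by (intro has_derivative_add has_derivative_cnj) (auto simp: has_field_derivative_def)
  then show ?thesis
    using assms(1,2) by (rule has_derivative_transform_within_open) (simp add: f)
qed

text \<open>The function \<open>f\<close> is only required to agree with \<open>h + cnj g\<close> on \<open>S\<close>, so that the rule can
  be iterated: the first partial derivatives are known on \<open>S\<close> alone, and they have the same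
  form again.\<close>

lemma pd_add_cnj:
  assumes "open S" "z \<in> S" "h holomorphic_on S" "g holomorphic_on S"
    and f: "\<And>w. w \<in> S \<Longrightarrow> f w = h w + cnj (g w)"
  shows "pd_x f z = deriv h z + cnj (deriv g z)"
    and "pd_y f z = \<i> * deriv h z + cnj (\<i> * deriv g z)"
proof -
  have along: "((\<lambda>t. f (z + c * of_real t)) has_vector_derivative
      (deriv h z * c + cnj (deriv g z * c))) (at 0)" for c
  proof -
    have "((\<lambda>t. z + c * of_real t) has_derivative (\<lambda>t. c * of_real t)) (at (0::real))"
      by (auto intro!: derivative_eq_intros)
    moreover have "(f has_derivative (\<lambda>v. deriv h z * v + cnj (deriv g z * v)))
        (at (z + c * of_real 0))"
      using has_derivative_add_cnj[OF assms] by simp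
    ultimately have "((\<lambda>t. f (z + c * of_real t)) has_derivative
        (\<lambda>t. deriv h z * (c * of_real t) + cnj (deriv g z * (c * of_real t)))) (at 0)"
      by (rule has_derivative_compose)
    then show ?thesis
      by (simp add: has_vector_derivative_def scaleR_conv_of_real algebra_simps)
  qed
  show "pd_x f z = deriv h z + cnj (deriv g z)"
    using vector_derivative_at[OF along[of 1]] by (simp add: pd_x_def)
  show "pd_y f z = \<i> * deriv h z + cnj (\<i> * deriv g z)"
    using vector_derivative_at[OF along[of \<i>]] by (simp add: pd_y_def mult.commute)
qed

lemma C1_on_add_cnj:
  assumes "open S" "h holomorphic_on S" "g holomorphic_on S"
    and f: "\<And>w. w \<in> S \<Longrightarrow> f w = h w + cnj (g w)"
  shows "C1_on S f"
proof -
  have "f differentiable_on S"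
    unfolding differentiable_on_def differentiable_def
    using has_derivative_at_withinI[OF has_derivative_add_cnj[OF assms(1) _ assms(2,3) f]] by blast
  moreover have "continuous_on S (deriv h)" "continuous_on S (deriv g)"
    using assms by (auto intro!: holomorphic_on_imp_continuous_on holomorphic_deriv)
  then have "continuous_on S (\<lambda>z. deriv h z + cnj (deriv g z))"
    "continuous_on S (\<lambda>z. \<i> * deriv h z + cnj (\<i> * deriv g z))"
    by (auto intro!: continuous_intros)
  then have "continuous_on S (pd_x f)" "continuous_on S (pd_y f)"
    using pd_add_cnj[OF assms(1) _ assms(2,3) f] by (simp_all cong: continuous_on_cong)
  ultimately show ?thesis
    by (simp add: C1_on_def)
qed

lemma harmonic_fun_on_add_cnj:
  assumes "open S" "h holomorphic_on S" "g holomorphic_on S"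
  shows "harmonic_fun_on S (\<lambda>z. h z + cnj (g z))"
proof -
  define f where "f = (\<lambda>z. h z + cnj (g z))"
  have h': "deriv h holomorphic_on S" "(\<lambda>z. \<i> * deriv h z) holomorphic_on S"
    and g': "deriv g holomorphic_on S" "(\<lambda>z. \<i> * deriv g z) holomorphic_on S"
    using assms by (auto intro!: holomorphic_intros holomorphic_deriv)
  have x: "pd_x f z = deriv h z + cnj (deriv g z)"
    and y: "pd_y f z = \<i> * deriv h z + cnj (\<i> * deriv g z)" if "z \<in> S" for z
    using pd_add_cnj[OF assms(1) that assms(2,3), of f] by (simp_all add: f_def)
  have xx: "pd_x (pd_x f) z = deriv (deriv h) z + cnj (deriv (deriv g) z)" if "z \<in> S" for z
    by (rule pd_add_cnj(1)[OF assms(1) that h'(1) g'(1) x])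
  have "pd_y (pd_y f) z
      = \<i> * deriv (\<lambda>z. \<i> * deriv h z) z + cnj (\<i> * deriv (\<lambda>z. \<i> * deriv g z) z)" if "z \<in> S" for z
    by (rule pd_add_cnj(2)[OF assms(1) that h'(2) g'(2) y])
  moreover have "deriv (\<lambda>z. \<i> * deriv h z) z = \<i> * deriv (deriv h) z"
    "deriv (\<lambda>z. \<i> * deriv g z) z = \<i> * deriv (deriv g) z" if "z \<in> S" for z
    using that assms(1) h'(1) g'(1)
    by (auto intro!: deriv_cmult holomorphic_on_imp_differentiable_at)
  ultimately have yy: "pd_y (pd_y f) z = - (deriv (deriv h) z + cnj (deriv (deriv g) z))"
    if "z \<in> S" for z
    using that by simp
  have "C1_on S f" "C1_on S (pd_x f)" "C1_on S (pd_y f)"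
    using C1_on_add_cnj[OF assms, of f] C1_on_add_cnj[OF assms(1) h'(1) g'(1) x]
      C1_on_add_cnj[OF assms(1) h'(2) g'(2) y] by (simp_all add: f_def)
  then show ?thesis
    using assms(1) xx yy by (simp add: harmonic_fun_on_def f_def)
qed

lemma jacobian_add_cnj:
  assumes "open S" "z \<in> S" "h holomorphic_on S" "g holomorphic_on S"
  shows "jacobian (\<lambda>z. h z + cnj (g z)) z = (norm (deriv h z))\<^sup>2 - (norm (deriv g z))\<^sup>2"
  using pd_add_cnj[OF assms, of "\<lambda>z. h z + cnj (g z)"]
  by (simp add: jacobian_def cmod_power2) (simp add: power2_eq_square algebra_simps)

section \<open>Starlike domains are close-to-convex\<close>

lemma starlike_imp_close_to_convex_domain:
  assumes "starlike_domain \<Omega>"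
  shows "close_to_convex_domain \<Omega>"
proof -
  have dom: "domain \<Omega>" and op: "open \<Omega>" and zero: "0 \<in> \<Omega>"
    and star: "\<And>w. w \<in> \<Omega> \<Longrightarrow> closed_segment 0 w \<subseteq> \<Omega>"
    using assms by (auto simp: starlike_domain_def domain_def)
  \<comment> \<open>The half-lines are the traces of the complement on the rays from the origin.\<close>
  define L where "L = {(p, d). norm d = 1 \<and> (\<exists>s\<ge>0. p = of_real s * d \<and>
      {t. 0 \<le> t \<and> of_real t * d \<notin> \<Omega>} = {s..})}"
  have away: "of_real t * d \<notin> \<Omega>" if "of_real s * d \<notin> \<Omega>" "0 \<le> s" "s \<le> t" for s t d
  proof
    assume "of_real t * d \<in> \<Omega>"
    moreover have "of_real s * d \<in> closed_segment 0 (of_real t * d)"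
    proof (cases "t = 0")
      case False
      then show ?thesis using that
        by (auto simp: in_segment scaleR_conv_of_real intro!: exI[of _ "s / t"])
    qed (use that in auto)
    ultimately show False using star that by blast
  qed
  have ray: "\<exists>(p, d)\<in>L. w \<in> closed_half_line p d" if w: "w \<notin> \<Omega>" for w
  proof -
    define T where "T = {t. 0 \<le> t \<and> of_real t * sgn w \<notin> \<Omega>}"
    have "w \<noteq> 0" using zero w by auto
    then have w_eq: "w = of_real (norm w) * sgn w"
      by (simp add: sgn_eq)
    then have wT: "norm w \<in> T"
      using w by (simp add: T_def)
    have bdd: "bdd_below T" by (auto simp: T_def)
    have "closed ((\<lambda>t. complex_of_real t * sgn w) -` (- \<Omega>))"
      using op by (intro closed_vimage) (auto intro!: continuous_intros)
    then have "closed ({0..} \<inter> (\<lambda>t. complex_of_real t * sgn w) -` (- \<Omega>))"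
      by (intro closed_Int) auto
    moreover have "T = {0..} \<inter> (\<lambda>t. complex_of_real t * sgn w) -` (- \<Omega>)"
      by (auto simp: T_def)
    ultimately have "closed T" by simp
    then have InfT: "Inf T \<in> T"
      using wT bdd closed_contains_Inf[of T] by blast
    have "T = {Inf T..}"
    proof
      show "T \<subseteq> {Inf T..}"
        using cInf_lower[OF _ bdd] by blast
      show "{Inf T..} \<subseteq> T"
      proof
        fix t assume t: "t \<in> {Inf T..}"
        have "0 \<le> Inf T" "of_real (Inf T) * sgn w \<notin> \<Omega>" using InfT by (simp_all add: T_def)
        with t away[of "Inf T" "sgn w" t] show "t \<in> T" by (simp add: T_def)
      qed
    qed
    moreover have "0 \<le> Inf T" using InfT by (simp add: T_def)
    ultimately have "\<exists>s\<ge>0. of_real (Inf T) * sgn w = of_real s * sgn w \<and>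
        {t. 0 \<le> t \<and> of_real t * sgn w \<notin> \<Omega>} = {s..}"
      unfolding T_def by blast
    then have "(of_real (Inf T) * sgn w, sgn w) \<in> L"
      using \<open>w \<noteq> 0\<close> by (simp add: L_def norm_sgn)
    moreover have "w \<in> closed_half_line (of_real (Inf T) * sgn w) (sgn w)"
    proof -
      have "w = of_real (Inf T) * sgn w + of_real (norm w - Inf T) * sgn w"
        by (subst w_eq) (simp add: algebra_simps)
      moreover have "0 \<le> norm w - Inf T" using cInf_lower[OF wT bdd] by simp
      ultimately show ?thesis unfolding closed_half_line_def by blast
    qed
    ultimately show ?thesis by blast
  qed
  have outside: "w \<notin> \<Omega>" if "(p, d) \<in> L" "w \<in> closed_half_line p d" for w p d
  proof -
    obtain s t where s: "0 \<le> s" "p = of_real s * d" "{t. 0 \<le> t \<and> of_real t * d \<notin> \<Omega>} = {s..}"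
      and t: "0 \<le> t" "w = p + of_real t * d"
      using \<open>(p, d) \<in> L\<close> \<open>w \<in> closed_half_line p d\<close> by (auto simp: L_def closed_half_line_def)
    then have "s + t \<in> {t. 0 \<le> t \<and> of_real t * d \<notin> \<Omega>}" "w = of_real (s + t) * d"
      by (auto simp: algebra_simps)
    then show ?thesis by simp
  qed
  have disj: "(p, d) = (q, e)"
    if L: "(p, d) \<in> L" "(q, e) \<in> L" and w: "w \<in> open_half_line p d" "w \<in> open_half_line q e"
    for p d q e w
  proof -
    obtain s t where s: "0 \<le> s" "p = of_real s * d" "{t. 0 \<le> t \<and> of_real t * d \<notin> \<Omega>} = {s..}"
      and t: "0 < t" "w = p + of_real t * d" "norm d = 1"
      using L w by (auto simp: L_def open_half_line_def)
    obtain s' t' where s': "0 \<le> s'" "q = of_real s' * e" "{t. 0 \<le> t \<and> of_real t * e \<notin> \<Omega>} = {s'..}"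
      and t': "0 < t'" "w = q + of_real t' * e" "norm e = 1"
      using L w by (auto simp: L_def open_half_line_def)
    have "w = of_real (s + t) * d" "w = of_real (s' + t') * e"
      using s t s' t' by (auto simp: algebra_simps)
    moreover have "sgn (of_real r * c) = c" if "0 < r" "norm c = 1" for r and c :: complex
      using that by (simp add: sgn_eq norm_mult)
    ultimately have de: "d = e"
      using s(1) t(1,3) s'(1) t'(1,3) by (metis add_nonneg_pos)
    then have "{s..} = {s'..}" using s s' by simp
    then show ?thesis using de s(2) s'(2) by simp
  qed
  have "- \<Omega> = (\<Union>(p, d)\<in>L. closed_half_line p d)"
    using ray outside by fast
  moreover have "\<forall>(p, d)\<in>L. norm d = 1"
    by (auto simp: L_def)
  moreover have "disjoint_family_on (\<lambda>(p, d). open_half_line p d) L"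
    using disj unfolding disjoint_family_on_def by fast
  ultimately show ?thesis
    unfolding close_to_convex_domain_def using dom by blast
qed

section \<open>A coefficient criterion for starlikeness\<close>

text \<open>The factor \<open>|w| / R\<close> is what turns the non-strict coefficient condition at \<open>R\<close> into a strict
  contraction inside the disk. The series start with exponent 2, as the perturbation of the
  identity has no linear part. The two perturbations are estimated together because the Jacobian needs
  the sum of their derivatives in modulus.\<close>

lemma dilated_contraction:
  fixes \<alpha> \<beta> :: "nat \<Rightarrow> complex"
  assumes R: "0 < R"
    and summ: "summable (\<lambda>n. real (n + 2) * (norm (\<alpha> n) + norm (\<beta> n)) * R ^ (n + 1))"
    and le1: "(\<Sum>n. real (n + 2) * (norm (\<alpha> n) + norm (\<beta> n)) * R ^ (n + 1)) \<le> 1"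
    and H: "\<And>z. norm z < R \<Longrightarrow> (\<lambda>n. \<alpha> n * z ^ (n + 2)) sums H z"
    and G: "\<And>z. norm z < R \<Longrightarrow> (\<lambda>n. \<beta> n * z ^ (n + 2)) sums G z"
    and zw: "norm z \<le> norm w" "norm w < R" and t: "0 \<le> t" "t \<le> 1"
  shows "norm (H w - of_real t * H z) + norm (G w - of_real t * G z)
         \<le> norm w / R * norm (w - of_real t * z)"
proof -
  define C where "C = (\<lambda>n. real (n + 2) * (norm (\<alpha> n) + norm (\<beta> n)) * R ^ (n + 1))"
  define \<delta> where "\<delta> = norm (w - of_real t * z)"
  define D where "D = (\<lambda>n. w ^ (n + 2) - of_real t * z ^ (n + 2))"
  have D: "norm (D n) \<le> real (n + 2) * norm w ^ (n + 1) * \<delta>" for n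
    using norm_power_diff_dilated_le[OF zw(1) t, of "Suc n"] by (simp add: D_def \<delta>_def)
  \<comment> \<open>Each term carries at least one factor of the modulus, hence the gain over the radius R.\<close>
  have pow: "norm w ^ (n + 1) \<le> norm w / R * R ^ (n + 1)" for n
    using R zw power_mono[of "norm w" R n] by (simp add: mult_left_mono)
  have bound: "norm (\<alpha> n * D n) + norm (\<beta> n * D n) \<le> norm w / R * \<delta> * C n" for n
  proof -
    have "norm (\<alpha> n * D n) + norm (\<beta> n * D n) = (norm (\<alpha> n) + norm (\<beta> n)) * norm (D n)"
      by (simp add: norm_mult algebra_simps)
    also have "\<dots> \<le> (norm (\<alpha> n) + norm (\<beta> n)) * (real (n + 2) * (norm w / R * R ^ (n + 1)) * \<delta>)"
      by (intro mult_left_mono order_trans[OF D] mult_right_mono pow) (auto simp: \<delta>_def)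
    also have "\<dots> = norm w / R * \<delta> * C n"
      by (simp add: C_def algebra_simps)
    finally show ?thesis .
  qed
  have sumC: "summable (\<lambda>n. norm w / R * \<delta> * C n)"
    using summ by (intro summable_mult) (simp add: C_def)
  have sa: "summable (\<lambda>n. norm (\<alpha> n * D n))"
  proof (rule summable_comparison_test'[OF sumC, of 0])
    show "norm (norm (\<alpha> n * D n)) \<le> norm w / R * \<delta> * C n" for n
      using bound[of n] norm_ge_zero[of "\<beta> n * D n"] unfolding real_norm_def abs_norm_cancel by linarith
  qed
  have sb: "summable (\<lambda>n. norm (\<beta> n * D n))"
  proof (rule summable_comparison_test'[OF sumC, of 0])
    show "norm (norm (\<beta> n * D n)) \<le> norm w / R * \<delta> * C n" for n
      using bound[of n] norm_ge_zero[of "\<alpha> n * D n"] unfolding real_norm_def abs_norm_cancel by linarith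
  qed
  have "(\<lambda>n. \<alpha> n * w ^ (n + 2) - of_real t * (\<alpha> n * z ^ (n + 2))) sums (H w - of_real t * H z)"
    using zw by (intro sums_diff sums_mult H) auto
  then have "(\<lambda>n. \<alpha> n * D n) sums (H w - of_real t * H z)"
    by (simp add: D_def algebra_simps)
  then have Hle: "norm (H w - of_real t * H z) \<le> (\<Sum>n. norm (\<alpha> n * D n))"
    using summable_norm[OF sa] by (simp add: sums_iff)
  have "(\<lambda>n. \<beta> n * w ^ (n + 2) - of_real t * (\<beta> n * z ^ (n + 2))) sums (G w - of_real t * G z)"
    using zw by (intro sums_diff sums_mult G) auto
  then have "(\<lambda>n. \<beta> n * D n) sums (G w - of_real t * G z)"
    by (simp add: D_def algebra_simps)
  then have "norm (G w - of_real t * G z) \<le> (\<Sum>n. norm (\<beta> n * D n))"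
    using summable_norm[OF sb] by (simp add: sums_iff)
  with Hle have "norm (H w - of_real t * H z) + norm (G w - of_real t * G z)
      \<le> (\<Sum>n. norm (\<alpha> n * D n)) + (\<Sum>n. norm (\<beta> n * D n))"
    by simp
  also have "\<dots> = (\<Sum>n. norm (\<alpha> n * D n) + norm (\<beta> n * D n))"
    using sa sb by (simp add: suminf_add)
  also have "\<dots> \<le> (\<Sum>n. norm w / R * \<delta> * C n)"
    using bound sa sb sumC by (intro suminf_le summable_add) auto
  also have "\<dots> = norm w / R * \<delta> * (\<Sum>n. C n)"
    using summ by (intro suminf_mult) (simp add: C_def)
  also have "\<dots> \<le> norm w / R * \<delta> * 1"
    using le1 R by (intro mult_left_mono) (auto simp: C_def \<delta>_def)
  finally show ?thesis by (simp add: \<delta>_def)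
qed

text \<open>Suppose the segment from 0 to \<open>f z\<close> leaves the image, and let \<open>\<rho>\<close> lie between \<open>|z|\<close> and \<open>R\<close>.
  Then the segment meets the frontier of the image of the disk of radius \<open>\<rho>\<close>. Since that image is
  open (invariance of domain), its frontier comes from the circle of radius \<open>\<rho>\<close>, where rigidity
  produces a point of modulus at most \<open>|z|\<close>.\<close>

lemma starlike_domain_image:
  fixes f :: "complex \<Rightarrow> complex"
  assumes R: "0 < R" and cont: "continuous_on (ball 0 R) f" and f0: "f 0 = 0"
    and rigid: "\<And>w z t. \<lbrakk>norm z \<le> norm w; norm w < R; 0 \<le> t; t \<le> 1; f w = of_real t * f z\<rbrakk>
                 \<Longrightarrow> w = of_real t * z"
  shows "inj_on f (ball 0 R)" and "starlike_domain (f ` ball 0 R)"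
proof -
  show inj: "inj_on f (ball 0 R)"
  proof (rule inj_onI)
    fix z w assume zw: "z \<in> ball 0 R" "w \<in> ball 0 R" "f z = f w"
    show "z = w"
    proof (cases "norm z \<le> norm w")
      case True
      then have "w = of_real 1 * z" by (rule rigid) (use zw in simp_all)
      then show ?thesis by simp
    next
      case False
      then have "norm w \<le> norm z" by simp
      then have "z = of_real 1 * w" by (rule rigid) (use zw in simp_all)
      then show ?thesis by simp
    qed
  qed
  have op: "open (f ` ball 0 r)" if "r \<le> R" for r
    by (rule invariance_of_domain)
       (use that in \<open>auto intro!: continuous_on_subset[OF cont] inj_on_subset[OF inj]\<close>)
  have segment: "closed_segment 0 (f z) \<subseteq> f ` ball 0 R" if z: "norm z < R" for z
  proof (rule ccontr)
    obtain \<rho> where \<rho>: "norm z < \<rho>" "\<rho> < R" using dense[OF z] by blast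
    then have "0 < \<rho>" using norm_ge_zero[of z] by linarith
    assume "\<not> closed_segment 0 (f z) \<subseteq> f ` ball 0 R"
    moreover have "f ` ball 0 \<rho> \<subseteq> f ` ball 0 R" using \<rho> by (intro image_mono) auto
    ultimately have "closed_segment 0 (f z) - f ` ball 0 \<rho> \<noteq> {}" by blast
    moreover have "0 \<in> f ` ball 0 \<rho>" using image_eqI[of 0 f 0 "ball 0 \<rho>"] f0 \<open>0 < \<rho>\<close> by simp
    then have "closed_segment 0 (f z) \<inter> f ` ball 0 \<rho> \<noteq> {}" by auto
    ultimately obtain p where p: "p \<in> closed_segment 0 (f z)" "p \<in> frontier (f ` ball 0 \<rho>)"
      using connected_Int_frontier[OF connected_segment(1)[of 0 "f z"], of "f ` ball 0 \<rho>"] by auto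
    have "compact (f ` cball 0 \<rho>)"
      by (rule compact_continuous_image) (use \<rho> in \<open>auto intro!: continuous_on_subset[OF cont]\<close>)
    then have "closure (f ` ball 0 \<rho>) \<subseteq> f ` cball 0 \<rho>"
      by (intro closure_minimal compact_imp_closed) auto
    moreover have "p \<in> closure (f ` ball 0 \<rho>)" "p \<notin> f ` ball 0 \<rho>"
      using p(2) op[of \<rho>] \<rho> by (auto simp: frontier_def interior_open)
    ultimately obtain w where w: "p = f w" "w \<in> cball 0 \<rho>" "w \<notin> ball 0 \<rho>"
      by blast
    then have norm_w: "norm w = \<rho>" by simp
    obtain t where t: "0 \<le> t" "t \<le> 1" "p = of_real t * f z"
      using p(1) by (auto simp: in_segment scaleR_conv_of_real)
    have "w = of_real t * z"
      using rigid[of z w t] w(1) norm_w t \<rho> by simp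
    then have "\<rho> = t * norm z"
      using norm_w t by (simp add: norm_mult)
    also have "\<dots> \<le> norm z"
      using t mult_left_le_one_le[of "norm z" t] by simp
    finally show False using \<rho> by simp
  qed
  have "0 \<in> f ` ball 0 R"
    using image_eqI[of 0 f 0 "ball 0 R"] f0 R by simp
  moreover have "connected (f ` ball 0 R)"
    using cont by (rule connected_continuous_image) (rule connected_ball)
  moreover have "open (f ` ball 0 R)"
    by (rule op) simp
  moreover have "\<forall>w\<in>f ` ball 0 R. closed_segment 0 w \<subseteq> f ` ball 0 R"
    using segment by simp
  ultimately show "starlike_domain (f ` ball 0 R)"
    unfolding starlike_domain_def domain_def by blast
qed

text \<open>A coefficient condition at the closed radius \<open>R\<close>, with equality allowed, suffices on the open
  disk, because every comparison takes place on a strictly smaller circle.\<close>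

theorem starlike_in_disk_coefficient_criterion:
  fixes \<alpha> \<beta> :: "nat \<Rightarrow> complex"
  assumes R: "0 < R"
    and summ: "summable (\<lambda>n. real (n + 2) * (norm (\<alpha> n) + norm (\<beta> n)) * R ^ (n + 1))"
    and le1: "(\<Sum>n. real (n + 2) * (norm (\<alpha> n) + norm (\<beta> n)) * R ^ (n + 1)) \<le> 1"
    and holo: "h holomorphic_on ball 0 R" "g holomorphic_on ball 0 R"
    and h: "\<And>z. norm z < R \<Longrightarrow> (\<lambda>n. \<alpha> n * z ^ (n + 2)) sums (h z - z)"
    and g: "\<And>z. norm z < R \<Longrightarrow> (\<lambda>n. \<beta> n * z ^ (n + 2)) sums g z"
  shows "starlike_in_disk (\<lambda>z. h z + cnj (g z)) R"
proof -
  define f where "f = (\<lambda>z. h z + cnj (g z))"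
  define H where "H = (\<lambda>z. h z - z)"
  have dil: "norm (H w - of_real t * H z) + norm (g w - of_real t * g z)
      \<le> norm w / R * norm (w - of_real t * z)"
    if "norm z \<le> norm w" "norm w < R" "0 \<le> t" "t \<le> 1" for w z t
    using dilated_contraction[OF R summ le1, of H g] h g that by (simp add: H_def)
  have rigid: "w = of_real t * z"
    if *: "norm z \<le> norm w" "norm w < R" "0 \<le> t" "t \<le> 1" "f w = of_real t * f z" for w z t
  proof (rule ccontr)
    assume "w \<noteq> of_real t * z"
    then have pos: "0 < norm (w - of_real t * z)" by simp
    have "w - of_real t * z = - ((H w - of_real t * H z) + cnj (g w - of_real t * g z))"
      using *(5) by (simp add: f_def H_def algebra_simps)
    then have "norm (w - of_real t * z) \<le> norm (H w - of_real t * H z) + norm (g w - of_real t * g z)"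
      by (metis complex_mod_cnj norm_minus_cancel norm_triangle_ineq)
    also have "\<dots> \<le> norm w / R * norm (w - of_real t * z)"
      using dil * by blast
    also have "\<dots> < 1 * norm (w - of_real t * z)"
      using *(2) R pos by (intro mult_strict_right_mono) auto
    finally show False by simp
  qed
  have cont: "continuous_on (ball 0 R) f"
    unfolding f_def using holo[THEN holomorphic_on_imp_continuous_on]
    by (intro continuous_intros) auto
  have f0: "f 0 = 0"
  proof -
    have "h 0 - 0 = 0" "g 0 = 0"
      using sums_unique[OF h[of 0]] sums_unique[OF g[of 0]] R by simp_all
    then show ?thesis by (simp add: f_def)
  qed
  have "jacobian f z > 0" if z: "z \<in> ball 0 R" for z
  proof -
    have dh: "(h has_field_derivative deriv h z) (at z)" "(g has_field_derivative deriv g z) (at z)"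
      using z holo by (auto intro!: holomorphic_derivI[of _ "ball 0 R"])
    then have dH: "(H has_field_derivative (deriv h z - 1)) (at z)"
      unfolding H_def by (auto intro!: derivative_eq_intros)
    \<comment> \<open>The contraction estimate with \<open>t = 1\<close> passes to the limit of difference quotients.\<close>
    have lim: "((\<lambda>w. norm ((H w - H z) / (w - z)) + norm ((g w - g z) / (w - z)))
        \<longlongrightarrow> norm (deriv h z - 1) + norm (deriv g z)) (at z)"
      using dH dh(2) by (intro tendsto_intros) (auto simp: has_field_derivative_iff)
    obtain \<rho> where \<rho>: "norm z < \<rho>" "\<rho> < R" using dense[of "norm z" R] z by auto
    have "eventually (\<lambda>w. w \<in> ball 0 \<rho>) (at z)"
      using \<rho> by (intro eventually_at_in_open') auto
    moreover have "eventually (\<lambda>w. w \<noteq> z) (at z)"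
      by (simp add: eventually_at_filter)
    ultimately have "eventually (\<lambda>w. norm ((H w - H z) / (w - z)) + norm ((g w - g z) / (w - z))
        \<le> \<rho> / R) (at z)"
    proof eventually_elim
      case (elim w)
      have "norm (H w - H z) + norm (g w - g z) \<le> max (norm w) (norm z) / R * norm (w - z)"
      proof (cases "norm z \<le> norm w")
        case True
        then show ?thesis using dil[of z w 1] elim \<rho> by (simp add: max_def)
      next
        case False
        then show ?thesis using dil[of w z 1] \<rho> by (simp add: max_def norm_minus_commute)
      qed
      also have "\<dots> \<le> \<rho> / R * norm (w - z)"
        using elim \<rho> R by (intro mult_right_mono divide_right_mono) auto
      finally show ?case
        using elim by (simp add: norm_divide add_divide_distrib[symmetric] pos_divide_le_eq)
    qed
    then have "norm (deriv h z - 1) + norm (deriv g z) \<le> \<rho> / R"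
      using lim by (intro tendsto_upperbound) auto
    moreover have "\<rho> / R < 1" using \<rho> R by simp
    moreover have "1 \<le> norm (deriv h z) + norm (deriv h z - 1)"
      using norm_triangle_ineq4[of "deriv h z" "deriv h z - 1"] by simp
    ultimately have "norm (deriv g z) < norm (deriv h z)" by linarith
    then have "(norm (deriv g z))\<^sup>2 < (norm (deriv h z))\<^sup>2"
      by (intro power_strict_mono) auto
    then show ?thesis
      using jacobian_add_cnj[OF open_ball z holo] by (simp add: f_def)
  qed
  then show ?thesis
    using starlike_domain_image[OF R cont f0 rigid] harmonic_fun_on_add_cnj[OF open_ball holo]
    by (simp add: starlike_in_disk_def sense_preserving_on_def f_def)
qed

section \<open>The radius and the majorant series\<close>

lemma has_field_derivative_divide_power_one_minus:
  fixes z :: "'a::real_normed_field"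
  assumes "z \<noteq> 1"
  shows "((\<lambda>w. c / (1 - w) ^ n) has_field_derivative of_nat n * c / (1 - z) ^ Suc n) (at z)"
proof -
  have "((\<lambda>w. inverse (1 - w)) has_field_derivative (inverse (1 - z))\<^sup>2) (at z)"
    using assms by (auto intro!: derivative_eq_intros simp: power2_eq_square)
  from DERIV_cmult[OF DERIV_power[OF this], of c n] show ?thesis
    by (cases n) (simp_all add: divide_inverse power_inverse power2_eq_square mult_ac)
qed

lemma geometric_deriv2_sums:
  fixes z :: "'a::{real_normed_field,banach}"
  assumes "norm z < 1"
  shows "(\<lambda>n. of_nat ((n + 1) * (n + 2)) * z ^ n) sums (2 / (1 - z) ^ 3)"
proof -
  have "(\<lambda>n. diffs (\<lambda>n. of_nat (Suc n)) n * z ^ n) sums (2 / (1 - z) ^ 3)"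
  proof (rule termdiffs_sums_strong)
    show "(\<lambda>n. of_nat (Suc n) * w ^ n) sums (1 / (1 - w)\<^sup>2)" if "norm w < 1" for w :: 'a
      using geometric_deriv_sums[OF that] by simp
    have "z \<noteq> 1" using assms by auto
    then show "((\<lambda>w. 1 / (1 - w)\<^sup>2) has_field_derivative 2 / (1 - z) ^ 3) (at z)"
      using has_field_derivative_divide_power_one_minus[of z 1 2] by (simp add: numeral_3_eq_3)
  qed (use assms in auto)
  then show ?thesis by (simp add: diffs_def algebra_simps)
qed

lemma geometric_deriv3_sums:
  fixes z :: "'a::{real_normed_field,banach}"
  assumes "norm z < 1"
  shows "(\<lambda>n. of_nat ((n + 1) * (n + 2) * (n + 3)) * z ^ n) sums (6 / (1 - z) ^ 4)"
proof -
  have "(\<lambda>n. diffs (\<lambda>n. of_nat ((n + 1) * (n + 2))) n * z ^ n) sums (6 / (1 - z) ^ 4)"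
  proof (rule termdiffs_sums_strong)
    show "(\<lambda>n. of_nat ((n + 1) * (n + 2)) * w ^ n) sums (2 / (1 - w) ^ 3)" if "norm w < 1" for w :: 'a
      by (rule geometric_deriv2_sums[OF that])
    have "z \<noteq> 1" using assms by auto
    then show "((\<lambda>w. 2 / (1 - w) ^ 3) has_field_derivative 6 / (1 - z) ^ 4) (at z)"
      using has_field_derivative_divide_power_one_minus[of z 2 3] by (simp add: eval_nat_numeral)
  qed (use assms in auto)
  then show ?thesis by (simp add: diffs_def algebra_simps)
qed

text \<open>In the basis of rising factorials, with \<open>n = m + 1\<close>,
  \<open>n (2 n\<^sup>2 + 1) / 3 = 2/3 (m + 1)(m + 2)(m + 3) - 2 (m + 1)(m + 2) + (m + 1)\<close>; this is where the
  coefficients of the partial fractions come from. The same fractions are the derivative of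
  the extremal function on the real axis.\<close>

lemma partial_fraction_majorant:
  fixes r :: real
  assumes "r \<noteq> 1"
  shows "2 / 3 * (6 / (1 - r) ^ 4) - 2 * (2 / (1 - r) ^ 3) + 1 / (1 - r)\<^sup>2
         = (1 + r)\<^sup>2 / (1 - r) ^ 4"
proof -
  define u where "u = 1 - r"
  have "u \<noteq> 0" and r: "r = 1 - u" using assms by (auto simp: u_def)
  have "2 / 3 * (6 / u ^ 4) - 2 * (2 / u ^ 3) + 1 / u\<^sup>2 = (2 - u)\<^sup>2 / u ^ 4"
    using \<open>u \<noteq> 0\<close> by (simp add: field_simps eval_nat_numeral)
  then show ?thesis by (simp add: r)
qed

lemma majorant_sums:
  fixes r :: real
  assumes "\<bar>r\<bar> < 1"
  shows "(\<lambda>n. real (n + 1) * (2 * (real n + 1)\<^sup>2 + 1) / 3 * r ^ n) sums ((1 + r)\<^sup>2 / (1 - r) ^ 4)"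
proof -
  have r: "norm r < 1" "1 - r \<noteq> 0" using assms by auto
  have "(\<lambda>n. 2 / 3 * (of_nat ((n + 1) * (n + 2) * (n + 3)) * r ^ n)
      - 2 * (of_nat ((n + 1) * (n + 2)) * r ^ n) + of_nat (Suc n) * r ^ n)
      sums (2 / 3 * (6 / (1 - r) ^ 4) - 2 * (2 / (1 - r) ^ 3) + 1 / (1 - r)\<^sup>2)"
    by (intro sums_add sums_diff sums_mult geometric_deriv3_sums geometric_deriv2_sums
        geometric_deriv_sums r)
  moreover have "2 / 3 * (of_nat ((n + 1) * (n + 2) * (n + 3)) * r ^ n)
      - 2 * (of_nat ((n + 1) * (n + 2)) * r ^ n) + of_nat (Suc n) * r ^ n
      = real (n + 1) * (2 * (real n + 1)\<^sup>2 + 1) / 3 * r ^ n" for n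
    by (simp add: field_simps power2_eq_square)
  moreover have "2 / 3 * (6 / (1 - r) ^ 4) - 2 * (2 / (1 - r) ^ 3) + 1 / (1 - r)\<^sup>2
      = (1 + r)\<^sup>2 / (1 - r) ^ 4"
    by (rule partial_fraction_majorant) (use r in auto)
  ultimately show ?thesis by (simp only:)
qed

lemma r_S_bounds: "0.1129025 < r_S" "r_S < 0.1129035"
proof -
  have s: "1.4142135 \<le> sqrt 2"
    by (rule real_le_rsqrt) (simp add: power2_eq_square)
  have s': "sqrt 2 \<le> 1.4142136"
    by (rule real_le_lsqrt) (simp_all add: power2_eq_square)
  have "sqrt (sqrt 2 + 1 / 8) \<le> 1.2406506"
    using s s' by (intro real_le_lsqrt) (auto simp: power2_eq_square)
  then show "0.1129025 < r_S" using s s' by (simp add: r_S_def)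
  have "1.2406503 \<le> sqrt (sqrt 2 + 1 / 8)"
    using s s' by (intro real_le_rsqrt) (auto simp: power2_eq_square)
  then show "r_S < 0.1129035" using s s' by (simp add: r_S_def)
qed

lemma quadratic_factorization:
  "sqrt 2 * r\<^sup>2 - (1 + 2 * sqrt 2) * r + sqrt 2 - 1
   = sqrt 2 * (r - r_S) * (r - (1 + sqrt 2 / 4 + sqrt (sqrt 2 + 1 / 8)))"
proof -
  define q where "q = sqrt (sqrt 2 + 1 / 8)"
  have q: "q * q = sqrt 2 + 1 / 8"
    by (simp add: q_def)
  have "sqrt 2 * (r - r_S) * (r - (1 + sqrt 2 / 4 + q))
      = sqrt 2 * ((r - 1 - sqrt 2 / 4)\<^sup>2 - q * q)"
    by (simp add: r_S_def q_def[symmetric] power2_eq_square algebra_simps)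
  also have "\<dots> = sqrt 2 * r\<^sup>2 - (1 + 2 * sqrt 2) * r + sqrt 2 - 1"
    unfolding q by (simp add: power2_eq_square algebra_simps)
  finally show ?thesis by (simp add: q_def)
qed

lemma quadratic_root_iff:
  assumes "r < 1"
  shows "sqrt 2 * r\<^sup>2 - (1 + 2 * sqrt 2) * r + sqrt 2 - 1 = 0 \<longleftrightarrow> r = r_S"
proof -
  have "0 < sqrt 2 / 4 + sqrt (sqrt 2 + 1 / 8)"
    by (intro add_pos_pos) (auto intro: add_pos_pos)
  then show ?thesis
    using assms unfolding quadratic_factorization by auto
qed

text \<open>The quadratic is the difference \<open>sqrt 2 (1 - r)\<^sup>2 - (1 + r)\<close> of the square roots of
  \<open>2 (1 - r) ^ 4\<close> and \<open>(1 + r)\<^sup>2\<close>, so its sign decides whether the majorant lies below 2. Its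
  second root exceeds 1.\<close>

lemma majorant_less_2_iff:
  assumes "0 \<le> r" "r < 1"
  shows "(1 + r)\<^sup>2 / (1 - r) ^ 4 < 2 \<longleftrightarrow> r < r_S"
    and "(1 + r)\<^sup>2 / (1 - r) ^ 4 = 2 \<longleftrightarrow> r = r_S"
proof -
  define A where "A = 1 + r"
  define B where "B = sqrt 2 * (1 - r)\<^sup>2"
  define K where "K = 1 + sqrt 2 / 4 + sqrt (sqrt 2 + 1 / 8)"
  define c where "c = sqrt 2 * (K - r)"
  have AB: "0 \<le> A" "0 \<le> B" using assms by (auto simp: A_def B_def)
  have "0 < sqrt 2 / 4 + sqrt (sqrt 2 + 1 / 8)"
    by (intro add_pos_pos) (auto intro: add_pos_pos)
  then have c: "0 < c" using assms by (simp add: c_def K_def)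
  have "B - A = sqrt 2 * r\<^sup>2 - (1 + 2 * sqrt 2) * r + sqrt 2 - 1"
    by (simp add: A_def B_def power2_eq_square algebra_simps)
  also have "\<dots> = c * (r_S - r)"
    unfolding quadratic_factorization K_def[symmetric] c_def by (simp add: algebra_simps)
  finally have eq: "B - A = c * (r_S - r)" .
  have "B\<^sup>2 = 2 * (1 - r) ^ 4"
    by (simp add: B_def power_mult_distrib)
  then have q: "(1 + r)\<^sup>2 / (1 - r) ^ 4 = 2 * A\<^sup>2 / B\<^sup>2" "0 < B\<^sup>2"
    using assms by (simp_all add: A_def)
  have "(1 + r)\<^sup>2 / (1 - r) ^ 4 < 2 \<longleftrightarrow> A\<^sup>2 < B\<^sup>2"
    unfolding q(1) using q(2) by (simp add: divide_simps)
  also have "\<dots> \<longleftrightarrow> 0 < B - A"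
    using AB power2_less_imp_less[of A B] power_strict_mono[of A B 2] by auto
  also have "\<dots> \<longleftrightarrow> r < r_S"
    using c by (simp add: eq zero_less_mult_iff)
  finally show "(1 + r)\<^sup>2 / (1 - r) ^ 4 < 2 \<longleftrightarrow> r < r_S" .
  have "(1 + r)\<^sup>2 / (1 - r) ^ 4 = 2 \<longleftrightarrow> A\<^sup>2 = B\<^sup>2"
    unfolding q(1) using q(2) by (simp add: divide_simps)
  also have "\<dots> \<longleftrightarrow> B - A = 0"
    using AB by auto
  also have "\<dots> \<longleftrightarrow> r = r_S"
    using c by (auto simp: eq)
  finally show "(1 + r)\<^sup>2 / (1 - r) ^ 4 = 2 \<longleftrightarrow> r = r_S" .
qed

theorem coeff_bounded_pair_starlike:
  assumes "coeff_bounded_pair a b h g"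
  shows "starlike_in_disk (\<lambda>z. h z + cnj (g z)) r_S"
proof -
  have R: "0 < r_S" "r_S < 1" using r_S_bounds by auto
  have holo: "h holomorphic_on ball 0 1" "g holomorphic_on ball 0 1"
    and hs: "\<And>z. norm z < 1 \<Longrightarrow> (\<lambda>n. a (n + 2) * z ^ (n + 2)) sums (h z - z)"
    and gs: "\<And>z. norm z < 1 \<Longrightarrow> (\<lambda>n. b (n + 1) * z ^ (n + 1)) sums g z"
    and a: "\<And>n. n \<ge> 1 \<Longrightarrow> norm (a n) \<le> (2 * real n + 1) * (real n + 1) / 6"
    and b: "\<And>n. n \<ge> 1 \<Longrightarrow> norm (b n) \<le> (2 * real n - 1) * (real n - 1) / 6"
    using assms by (auto simp: coeff_bounded_pair_def)
  have "b 1 = 0" using b[of 1] by simp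
  then have gs2: "(\<lambda>n. b (n + 2) * z ^ (n + 2)) sums g z" if "norm z < 1" for z
    using gs[OF that] sums_Suc_iff[of "\<lambda>n. b (n + 1) * z ^ (n + 1)" "g z"] by simp
  define C where "C = (\<lambda>n. real (n + 2) * (norm (a (n + 2)) + norm (b (n + 2))) * r_S ^ (n + 1))"
  define M where "M = (\<lambda>n. real (n + 1) * (2 * (real n + 1)\<^sup>2 + 1) / 3 * r_S ^ n)"
  have "M sums 2"
    using majorant_sums[of r_S] majorant_less_2_iff(2)[of r_S] R by (simp add: M_def)
  \<comment> \<open>Dropping the linear term, which belongs to the identity, leaves exactly 1.\<close>
  then have M: "(\<lambda>n. M (Suc n)) sums 1"
    using sums_Suc_iff[of M 1] by (simp add: M_def)
  have CM: "C n \<le> M (Suc n)" for n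
  proof -
    have "norm (a (n + 2)) + norm (b (n + 2)) \<le> (2 * (real n + 2)\<^sup>2 + 1) / 3"
      using a[of "n + 2"] b[of "n + 2"] by (simp add: field_simps power2_eq_square)
    then have "C n \<le> real (n + 2) * ((2 * (real n + 2)\<^sup>2 + 1) / 3) * r_S ^ (n + 1)"
      unfolding C_def using R by (intro mult_right_mono mult_left_mono) auto
    also have "\<dots> = M (Suc n)"
      by (simp add: M_def add.commute)
    finally show ?thesis .
  qed
  have C: "summable C"
    by (rule summable_comparison_test'[of "\<lambda>n. M (Suc n)" 0])
       (use CM M R in \<open>auto simp: sums_iff C_def\<close>)
  have "suminf C \<le> 1"
    using suminf_le[OF CM C] M by (simp add: sums_iff)
  show ?thesis
  proof (rule starlike_in_disk_coefficient_criterion)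
    show "summable (\<lambda>n. real (n + 2) * (norm (a (n + 2)) + norm (b (n + 2))) * r_S ^ (n + 1))"
      using C by (simp only: C_def)
    show "(\<Sum>n. real (n + 2) * (norm (a (n + 2)) + norm (b (n + 2))) * r_S ^ (n + 1)) \<le> 1"
      using \<open>suminf C \<le> 1\<close> by (simp only: C_def)
    show "h holomorphic_on ball 0 r_S" "g holomorphic_on ball 0 r_S"
      using holo R by (auto elim!: holomorphic_on_subset)
    show "(\<lambda>n. a (n + 2) * z ^ (n + 2)) sums (h z - z)" if "norm z < r_S" for z
      using that R by (intro hs) simp
    show "(\<lambda>n. b (n + 2) * z ^ (n + 2)) sums g z" if "norm z < r_S" for z
      using that R by (intro gs2) simp
  qed (rule R)
qed

section \<open>Sharpness\<close>

text \<open>The harmonic Koebe function of Clunie and Sheil-Small is \<open>koebe_h + cnj koebe_g\<close>;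
  its coefficients are exactly the two bounds. The partial fractions correspond to the expansions
  \<open>(2 n + 1)(n + 1) = 2 n (n + 1) + n + 1\<close> and \<open>(2 n - 1)(n - 1) = 2 n (n + 1) - 5 n + 1\<close>.\<close>

definition koebe_h :: "complex \<Rightarrow> complex" where
  "koebe_h z = z / 6 * (2 * (2 / (1 - z) ^ 3) + 1 / (1 - z)\<^sup>2 + 1 / (1 - z))"

definition koebe_g :: "complex \<Rightarrow> complex" where
  "koebe_g z = z / 6 * (2 * (2 / (1 - z) ^ 3) - 5 * (1 / (1 - z)\<^sup>2) + 1 / (1 - z))"

lemma koebe_h_sums:
  assumes "norm z < 1"
  shows "(\<lambda>n. of_real ((2 * real (n + 1) + 1) * (real (n + 1) + 1) / 6) * z ^ (n + 1)) sums koebe_h z"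
proof -
  have "(\<lambda>n. z / 6 * (2 * (of_nat ((n + 1) * (n + 2)) * z ^ n) + of_nat (Suc n) * z ^ n + z ^ n))
      sums (z / 6 * (2 * (2 / (1 - z) ^ 3) + 1 / (1 - z)\<^sup>2 + 1 / (1 - z)))"
    by (intro sums_add sums_mult geometric_deriv2_sums geometric_deriv_sums geometric_sums assms)
  moreover have "z / 6 * (2 * (of_nat ((n + 1) * (n + 2)) * z ^ n) + of_nat (Suc n) * z ^ n + z ^ n)
      = of_real ((2 * real (n + 1) + 1) * (real (n + 1) + 1) / 6) * z ^ (n + 1)" for n
    by (simp add: field_simps)
  ultimately show ?thesis by (simp only: koebe_h_def)
qed

lemma koebe_g_sums:
  assumes "norm z < 1"
  shows "(\<lambda>n. of_real ((2 * real (n + 1) - 1) * (real (n + 1) - 1) / 6) * z ^ (n + 1)) sums koebe_g z"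
proof -
  have "(\<lambda>n. z / 6 * (2 * (of_nat ((n + 1) * (n + 2)) * z ^ n) - 5 * (of_nat (Suc n) * z ^ n) + z ^ n))
      sums (z / 6 * (2 * (2 / (1 - z) ^ 3) - 5 * (1 / (1 - z)\<^sup>2) + 1 / (1 - z)))"
    by (intro sums_add sums_diff sums_mult geometric_deriv2_sums geometric_deriv_sums geometric_sums assms)
  moreover have "z / 6 * (2 * (of_nat ((n + 1) * (n + 2)) * z ^ n) - 5 * (of_nat (Suc n) * z ^ n) + z ^ n)
      = of_real ((2 * real (n + 1) - 1) * (real (n + 1) - 1) / 6) * z ^ (n + 1)" for n
    by (simp add: field_simps)
  ultimately show ?thesis by (simp only: koebe_g_def)
qed

text \<open>All signs but that of the linear term are reversed, so that on the positive real axis the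
  perturbation of the identity works against it everywhere.\<close>

lemma coeff_bounded_pair_extremal:
  "coeff_bounded_pair
     (\<lambda>n. if n = 1 then 1 else - of_real ((2 * real n + 1) * (real n + 1) / 6))
     (\<lambda>n. - of_real ((2 * real n - 1) * (real n - 1) / 6))
     (\<lambda>z. 2 * z - koebe_h z) (\<lambda>z. - koebe_g z)"
proof -
  have h: "(\<lambda>n. - of_real ((2 * real (n + 2) + 1) * (real (n + 2) + 1) / 6) * z ^ (n + 2))
      sums ((2 * z - koebe_h z) - z)" if "norm z < 1" for z
  proof -
    have "(\<lambda>n. of_real ((2 * real (n + 2) + 1) * (real (n + 2) + 1) / 6) * z ^ (n + 2))
        sums (koebe_h z - z)"
      using koebe_h_sums[OF that] sums_Suc_iff[of
          "\<lambda>n. of_real ((2 * real (n + 1) + 1) * (real (n + 1) + 1) / 6) * z ^ (n + 1)" "koebe_h z - z"]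
      by simp
    from sums_minus[OF this] show ?thesis by simp
  qed
  have g: "(\<lambda>n. - of_real ((2 * real (n + 1) - 1) * (real (n + 1) - 1) / 6) * z ^ (n + 1))
      sums (- koebe_g z)" if "norm z < 1" for z
    using sums_minus[OF koebe_g_sums[OF that]] by simp
  have holo: "koebe_h holomorphic_on ball 0 1" "koebe_g holomorphic_on ball 0 1"
    unfolding koebe_h_def koebe_g_def by (auto intro!: holomorphic_intros)
  have norm_real: "norm (- complex_of_real x) \<le> x" if "0 \<le> x" for x
    using that by simp
  show ?thesis
    unfolding coeff_bounded_pair_def
  proof (intro conjI ballI allI impI)
    show "(\<lambda>z. 2 * z - koebe_h z) holomorphic_on ball 0 1" "(\<lambda>z. - koebe_g z) holomorphic_on ball 0 1"
      using holo by (intro holomorphic_intros; simp)+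
  next
    fix z :: complex assume "z \<in> ball 0 1"
    then have z: "norm z < 1" by simp
    show "(\<lambda>n. (if n + 2 = 1 then 1 else - of_real ((2 * real (n + 2) + 1) * (real (n + 2) + 1) / 6))
        * z ^ (n + 2)) sums (2 * z - koebe_h z - z)"
      using h[OF z] by simp
    show "(\<lambda>n. - of_real ((2 * real (n + 1) - 1) * (real (n + 1) - 1) / 6) * z ^ (n + 1))
        sums (- koebe_g z)"
      by (rule g[OF z])
  next
    fix n :: nat assume n: "1 \<le> n"
    show "norm (if n = 1 then 1 else - complex_of_real ((2 * real n + 1) * (real n + 1) / 6))
        \<le> (2 * real n + 1) * (real n + 1) / 6"
    proof (cases "n = 1")
      case False
      have "0 \<le> (2 * real n + 1) * (real n + 1) / 6"
        by (intro divide_nonneg_nonneg mult_nonneg_nonneg) auto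
      from norm_real[OF this] show ?thesis using False by (simp only: if_False)
    qed simp
    show "norm (- complex_of_real ((2 * real n - 1) * (real n - 1) / 6))
        \<le> (2 * real n - 1) * (real n - 1) / 6"
      using n by (intro norm_real divide_nonneg_nonneg mult_nonneg_nonneg) auto
  qed (simp only: if_True simp_thms)
qed

text \<open>The restriction of the extremal map to the real axis.\<close>

definition extremal_profile :: "real \<Rightarrow> real" where
  "extremal_profile x = 2 * x - x / 3 * (4 / (1 - x) ^ 3 - 2 / (1 - x)\<^sup>2 + 1 / (1 - x))"

lemma extremal_on_real_axis:
  "2 * of_real x - koebe_h (of_real x) + cnj (- koebe_g (of_real x)) = of_real (extremal_profile x)"
proof -
  define A B C where "A = 1 / (1 - x) ^ 3" and "B = 1 / (1 - x)\<^sup>2" and "C = 1 / (1 - x)"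
  define P Q where "P = x / 6 * (2 * (2 * A) + B + C)" and "Q = x / 6 * (2 * (2 * A) - 5 * B + C)"
  have "koebe_h (of_real x) = of_real P" "koebe_g (of_real x) = of_real Q"
    by (simp_all add: koebe_h_def koebe_g_def P_def Q_def A_def B_def C_def)
  then have "2 * of_real x - koebe_h (of_real x) + cnj (- koebe_g (of_real x))
      = complex_of_real (2 * x - P - Q)"
    by simp
  also have "2 * x - P - Q = 2 * x - x / 3 * (4 * A - 2 * B + C)"
    by (simp add: P_def Q_def field_simps)
  also have "\<dots> = extremal_profile x"
    by (simp add: extremal_profile_def A_def B_def C_def)
  finally show ?thesis .
qed

lemma extremal_profile_deriv:
  assumes "x < 1"
  shows "(extremal_profile has_real_derivative (2 - (1 + x)\<^sup>2 / (1 - x) ^ 4)) (at x)"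
proof -
  \<comment> \<open>The partial fraction form, in which each term is a power of \<open>1 / (1 - x)\<close>.\<close>
  define F where "F = (\<lambda>x::real. 2 * x - 4 / 3 / (1 - x) ^ 3 + 2 / (1 - x)\<^sup>2 - 1 / (1 - x) + 1 / 3)"
  have x: "x \<noteq> 1" using assms by simp
  have "((\<lambda>w. 4 / 3 / (1 - w) ^ 3) has_real_derivative 4 / (1 - x) ^ 4) (at x)"
    "((\<lambda>w. 2 / (1 - w)\<^sup>2) has_real_derivative 4 / (1 - x) ^ 3) (at x)"
    "((\<lambda>w. 1 / (1 - w)) has_real_derivative 1 / (1 - x)\<^sup>2) (at x)"
    using has_field_derivative_divide_power_one_minus[OF x, of "4 / 3" 3]
      has_field_derivative_divide_power_one_minus[OF x, of 2 2]
      has_field_derivative_divide_power_one_minus[OF x, of 1 1]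
    by (simp_all add: power2_eq_square)
  then have "(F has_real_derivative
      (2 * 1 - 4 / (1 - x) ^ 4 + 4 / (1 - x) ^ 3 - 1 / (1 - x)\<^sup>2 + 0)) (at x)"
    unfolding F_def by (intro DERIV_add DERIV_diff DERIV_cmult[of "\<lambda>x. x"] DERIV_ident DERIV_const)
  moreover have "2 * 1 - 4 / (1 - x) ^ 4 + 4 / (1 - x) ^ 3 - 1 / (1 - x)\<^sup>2 + 0
      = 2 - (1 + x)\<^sup>2 / (1 - x) ^ 4"
    unfolding partial_fraction_majorant[OF x, symmetric] by simp
  ultimately have "(F has_real_derivative (2 - (1 + x)\<^sup>2 / (1 - x) ^ 4)) (at x)"
    by (simp only:)
  then show ?thesis
  proof (rule has_field_derivative_transform_within_open)
    show "open {..<1::real}" "x \<in> {..<1}" using assms by auto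
  next
    fix y :: real assume less: "y \<in> {..<1}"
    define u where "u = 1 - y"
    have "u \<noteq> 0" using less by (auto simp: u_def)
    define A where "A = 4 / u ^ 3 - 2 / u\<^sup>2 + 1 / u"
    have "u * A = 4 / u\<^sup>2 - 2 / u + 1"
      using \<open>u \<noteq> 0\<close> by (simp add: A_def divide_simps power2_eq_square power3_eq_cube algebra_simps)
    moreover have "(1 - u) / 3 * A = (A - u * A) / 3"
      by (simp add: field_simps)
    ultimately have "(1 - u) / 3 * A = 4 / 3 / u ^ 3 - 2 / u\<^sup>2 + 1 / u - 1 / 3"
      by (simp add: A_def)
    moreover have "F y = 2 * y - (4 / 3 / u ^ 3 - 2 / u\<^sup>2 + 1 / u - 1 / 3)"
      by (simp add: F_def u_def)
    moreover have "extremal_profile y = 2 * y - (1 - u) / 3 * A"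
      by (simp add: extremal_profile_def A_def u_def)
    ultimately show "F y = extremal_profile y" by (simp only:)
  qed
qed

text \<open>An injective continuous function on an interval is monotone, whereas the profile rises
  up to \<open>r_S\<close> and falls afterwards.\<close>

lemma extremal_not_inj_on:
  assumes "r_S < r" "r \<le> 1"
  shows "\<not> inj_on (\<lambda>z. 2 * z - koebe_h z + cnj (- koebe_g z)) (ball 0 r)"
proof
  assume inj: "inj_on (\<lambda>z. 2 * z - koebe_h z + cnj (- koebe_g z)) (ball 0 r)"
  have R: "0 < r_S" "r_S < 1" using r_S_bounds by auto
  obtain y where y: "r_S < y" "y < r" using dense assms by blast
  have cont: "continuous_on {s..t} extremal_profile" if "t < 1" for s t
  proof (rule DERIV_continuous_on)
    fix x assume "x \<in> {s..t}"
    then have "x < 1" using that by simp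
    from has_field_derivative_at_within[OF extremal_profile_deriv[OF this]]
    show "(extremal_profile has_real_derivative 2 - (1 + x)\<^sup>2 / (1 - x) ^ 4) (at x within {s..t})" .
  qed
  have "inj_on extremal_profile {0..y}"
  proof (rule inj_onI)
    fix s t assume st: "s \<in> {0..y}" "t \<in> {0..y}" "extremal_profile s = extremal_profile t"
    have "complex_of_real s = complex_of_real t"
    proof (rule inj_onD[OF inj])
      show "2 * of_real s - koebe_h (of_real s) + cnj (- koebe_g (of_real s))
          = 2 * of_real t - koebe_h (of_real t) + cnj (- koebe_g (of_real t))"
        unfolding extremal_on_real_axis st(3) ..
    qed (use st y in auto)
    then show "s = t" by simp
  qed
  moreover have "continuous_on {0..y} extremal_profile"
    using y assms by (intro cont) simp
  ultimately have "(extremal_profile 0 < extremal_profile r_S \<and> extremal_profile r_S < extremal_profile y) \<or>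
      (extremal_profile y < extremal_profile r_S \<and> extremal_profile r_S < extremal_profile 0)"
    using continuous_inj_imp_mono[of 0 r_S y extremal_profile] R(1) y(1) by blast
  moreover have "extremal_profile 0 < extremal_profile r_S"
  proof (rule DERIV_pos_imp_increasing_open[of 0 r_S extremal_profile])
    fix x assume x: "0 < x" "x < r_S"
    then have "0 \<le> x" "x < 1" using R by simp_all
    then have "0 < 2 - (1 + x)\<^sup>2 / (1 - x) ^ 4" using majorant_less_2_iff(1)[of x] x(2) by simp
    then show "\<exists>d. (extremal_profile has_real_derivative d) (at x) \<and> 0 < d"
      using extremal_profile_deriv[OF \<open>x < 1\<close>] by blast
  next
    show "continuous_on {0..r_S} extremal_profile" using R by (intro cont) simp
  qed (rule R)
  moreover have "extremal_profile y < extremal_profile r_S"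
  proof (rule DERIV_neg_imp_decreasing_open[of r_S y extremal_profile])
    fix x assume x: "r_S < x" "x < y"
    then have x01: "0 \<le> x" "x < 1" "\<not> x < r_S" "x \<noteq> r_S" using R y assms by simp_all
    then have "\<not> (1 + x)\<^sup>2 / (1 - x) ^ 4 < 2" "(1 + x)\<^sup>2 / (1 - x) ^ 4 \<noteq> 2"
      by (simp_all only: majorant_less_2_iff not_False_eq_True)
    then have "2 - (1 + x)\<^sup>2 / (1 - x) ^ 4 < 0" by linarith
    then show "\<exists>d. (extremal_profile has_real_derivative d) (at x) \<and> d < 0"
      using extremal_profile_deriv[OF x01(2)] by blast
  next
    show "continuous_on {r_S..y} extremal_profile" using y assms by (intro cont) simp
  qed (rule y)
  ultimately show False by linarith
qed

theorem theorem1p5: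
  shows "(\<forall>a b h g. coeff_bounded_pair a b h g \<longrightarrow>
            close_to_convex_in_disk (\<lambda>z. h z + cnj (g z)) r_S \<and>
            starlike_in_disk (\<lambda>z. h z + cnj (g z)) r_S)
       \<and> (r_S \<in> {0<..<1} \<and>
          (\<forall>r\<in>{0<..<1}. sqrt 2 * r\<^sup>2 - (1 + 2 * sqrt 2) * r + sqrt 2 - 1 = 0 \<longleftrightarrow> r = r_S) \<and>
          \<bar>r_S - 0.112903\<bar> < 0.0000005)
       \<and> (\<forall>r. r_S < r \<and> r \<le> 1 \<longrightarrow>
            (\<exists>a b h g. coeff_bounded_pair a b h g \<and>
               \<not> inj_on (\<lambda>z. h z + cnj (g z)) (ball 0 r)))"
proof (intro conjI allI impI ballI)
  fix a b h g assume "coeff_bounded_pair a b h g"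
  then show star: "starlike_in_disk (\<lambda>z. h z + cnj (g z)) r_S"
    by (rule coeff_bounded_pair_starlike)
  then show "close_to_convex_in_disk (\<lambda>z. h z + cnj (g z)) r_S"
    using starlike_imp_close_to_convex_domain
    by (auto simp: starlike_in_disk_def close_to_convex_in_disk_def)
next
  show "r_S \<in> {0<..<1}" using r_S_bounds by simp
next
  show "sqrt 2 * r\<^sup>2 - (1 + 2 * sqrt 2) * r + sqrt 2 - 1 = 0 \<longleftrightarrow> r = r_S" if "r \<in> {0<..<1}" for r
    using that by (intro quadratic_root_iff) simp
next
  show "\<bar>r_S - 0.112903\<bar> < 0.0000005" unfolding abs_less_iff using r_S_bounds by (intro conjI) simp_all
next
  fix r assume "r_S < r \<and> r \<le> 1"
  then show "\<exists>a b h g. coeff_bounded_pair a b h g \<and>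
               \<not> inj_on (\<lambda>z. h z + cnj (g z)) (ball 0 r)"
    using coeff_bounded_pair_extremal extremal_not_inj_on by blast
qed

end
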